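(* Let $\mu=\sum_{i=1}^k w_i\,\delta(x_i)$ and $\nu=\sum_{i=1}^k w_i\,\delta(y_i)$ be discrete probability measures on $\mathbb{R}^d$ (with $w_i>0$, the $x_i$ pairwise distinct and the $y_i$ pairwise distinct), labelled so that the coupling $\sum_i w_i\,\delta_{(x_i,y_i)}$, with support $\Gamma=\{(x_1,y_1),\dots,(x_k,y_k)\}$, is an optimal transport plan between $\mu$ and $\nu$ for the quadratic cost. If $\sigma_*=R(\Gamma)>0$, then $$W_2^2(\mu,\nu)-W_2^2(\mu*\mathcal{N}_\sigma,\nu*\mathcal{N}_\sigma)\ \gtrsim\ \sup_{M>\sigma_*}e^{-cM^2/\sigma^2}\,G(M).$$ In particular, if $G(3\sigma_* )\gtrsim\sigma_*$, then for $\sigma\in(0,2\sigma_* )$, $$W_2^2(\mu,\nu)-W_2^2(\mu*\mathcal{N}_\sigma,\nu*\mathcal{N}_\sigma)\ \gtrsim\ \sigma\,e^{-c\sigma_*^2/\sigma^2}.$$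
   Context: $W_2^2(\mu,\nu)=\inf_{\pi\in\Pi(\mu,\nu)}\int\|x-y\|^2\,d\pi(x,y)$, where $\Pi(\mu,\nu)$ is the set of couplings of $\mu$ and $\nu$ and $\|\cdot\|$ is the Euclidean norm. $\mathcal{N}_\sigma$ ($\sigma>0$) is the centered Gaussian measure on $\mathbb{R}^d$ with covariance $\sigma^2 I_d$, $*$ is convolution, and $\delta(x)$ is the Dirac mass at $x$. The symbol $\gtrsim$ denotes an inequality up to an unspecified positive multiplicative constant, and $c>0$ is an unspecified constant (possibly different in the two displays); these constants do not depend on $\sigma$ or $M$. For $\epsilon\ge 0$, $\Gamma$ is called $\epsilon$-robust if for any distinct indices $\theta(1),\dots,\theta(n)\in\{1,\dots,k\}$ and any vectors $a_{\theta(1)},\dots,a_{\theta(n)}\in\mathbb{R}^d$ with $\max_i\|a_{\theta(i)}\|\le\epsilon$, $$\sum_{i=1}^n\|x_{\theta(i)}-y_{\theta(i)}\|^2\le\sum_{i=1}^n\|(x_{\theta(i)}+a_{\theta(i)})-(y_{\theta(i+1)}+a_{\theta(i+1)})\|^2,\qquad \theta(n+1):=\theta(1).$$ For $\Gamma$ an optimal transport plan, $R(\Gamma):=\sup\{\epsilon\ge 0:\Gamma\text{ is }\epsilon\text{-robust}\}$. For $M\ge 0$, $$G(M):=\sup\Big\{\sum_{i=1}^n\|x_{\theta(i)}-y_{\theta(i)}\|^2-\sum_{i=1}^n\|(x_{\theta(i)}+a_{\theta(i)})-(y_{\theta(i+1)}+a_{\theta(i+1)})\|^2\ :\ \|a_{\theta(i)}\|\le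 M\Big\},$$ where $n$, the indices $\theta(1),\dots,\theta(n)$ and the vectors $a_{\theta(i)}\in\mathbb{R}^d$ range as in the definition of $\epsilon$-robustness, except that the norm bound is now $M$. *)

theory Defs
  imports "HOL-Probability.Probability"
begin

definition couplings :: "'a measure \<Rightarrow> 'b measure \<Rightarrow> ('a \<times> 'b) measure set" where
  "couplings \<mu> \<nu> =
     {\<pi>. sets \<pi> = sets (\<mu> \<Otimes>\<^sub>M \<nu>) \<and> distr \<pi> \<mu> fst = \<mu> \<and> distr \<pi> \<nu> snd = \<nu>}"

definition quadratic_cost :: "('a::real_normed_vector \<times> 'a) measure \<Rightarrow> ennreal" where
  "quadratic_cost \<pi> = (\<integral>\<^sup>+ p. ennreal ((norm (fst p - snd p))\<^sup>2) \<partial>\<pi>)"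

text \<open>The squared Wasserstein distance. It takes values in \<^typ>\<open>ereal\<close>, so that differences of
  squared distances can be formed without first discarding the value \<open>\<infinity>\<close>.\<close>

definition W2_squared :: "'a::real_normed_vector measure \<Rightarrow> 'a measure \<Rightarrow> ereal" where
  "W2_squared \<mu> \<nu> = enn2ereal (INF \<pi>\<in>couplings \<mu> \<nu>. quadratic_cost \<pi>)"

definition optimal_plan ::
    "('a::real_normed_vector \<times> 'a) measure \<Rightarrow> 'a measure \<Rightarrow> 'a measure \<Rightarrow> bool" where
  "optimal_plan \<pi> \<mu> \<nu> \<longleftrightarrow>
     \<pi> \<in> couplings \<mu> \<nu> \<and> enn2ereal (quadratic_cost \<pi>) = W2_squared \<mu> \<nu>"

text \<open>The measure \<open>\<Sum>\<^sub>i w\<^sub>i \<delta>(z\<^sub>i)\<close>, with \<open>i\<close> ranging over \<open>1, \<dots>, k\<close>, as the image under \<open>z\<close> of the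
  measure on the index set that gives mass \<open>w\<^sub>i\<close> to \<open>i\<close>.\<close>

definition discrete_measure ::
    "nat \<Rightarrow> (nat \<Rightarrow> real) \<Rightarrow> (nat \<Rightarrow> 'a::topological_space) \<Rightarrow> 'a measure" where
  "discrete_measure k w z = distr (point_measure {1..k} (\<lambda>i. ennreal (w i))) borel z"

text \<open>The density below is \<open>(2 \<pi> \<sigma>\<^sup>2) powr (- d / 2) * exp (- (norm z)\<^sup>2 / (2 \<sigma>\<^sup>2))\<close>
  with \<open>d = CARD('n)\<close>, written as a product over the coordinates.\<close>

definition gaussian :: "real \<Rightarrow> (real ^ 'n) measure" where
  "gaussian \<sigma> = density lborel (\<lambda>z. ennreal (\<Prod>i\<in>UNIV. normal_density 0 \<sigma> (z $ i)))"

text \<open>A cycle \<open>\<theta>(1), \<dots>, \<theta>(n)\<close> of distinct indices, with \<open>n \<ge> 1\<close>.\<close>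

definition index_cycle :: "nat \<Rightarrow> nat \<Rightarrow> (nat \<Rightarrow> nat) \<Rightarrow> bool" where
  "index_cycle k n \<theta> \<longleftrightarrow> 1 \<le> n \<and> inj_on \<theta> {1..n} \<and> \<theta> ` {1..n} \<subseteq> {1..k}"

definition cyc_next :: "nat \<Rightarrow> nat \<Rightarrow> nat" where
  "cyc_next n i = (if i = n then 1 else i + 1)"

definition matched_cost ::
    "(nat \<Rightarrow> 'a::real_normed_vector) \<Rightarrow> (nat \<Rightarrow> 'a) \<Rightarrow> nat \<Rightarrow> (nat \<Rightarrow> nat) \<Rightarrow> real" where
  "matched_cost x y n \<theta> = (\<Sum>i=1..n. (norm (x (\<theta> i) - y (\<theta> i)))\<^sup>2)"

definition shifted_cost ::
    "(nat \<Rightarrow> 'a::real_normed_vector) \<Rightarrow> (nat \<Rightarrow> 'a) \<Rightarrow> nat \<Rightarrow> (nat \<Rightarrow> nat) \<Rightarrow> (nat \<Rightarrow> 'a) \<Rightarrow> real" where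
  "shifted_cost x y n \<theta> a =
     (\<Sum>i=1..n. (norm ((x (\<theta> i) + a (\<theta> i))
                    - (y (\<theta> (cyc_next n i)) + a (\<theta> (cyc_next n i)))))\<^sup>2)"

text \<open>In the following three definitions the set \<open>\<Gamma> = {(x\<^sub>1, y\<^sub>1), \<dots>, (x\<^sub>k, y\<^sub>k)}\<close> is given by
  its enumeration.\<close>

definition robust ::
    "nat \<Rightarrow> (nat \<Rightarrow> 'a::real_normed_vector) \<Rightarrow> (nat \<Rightarrow> 'a) \<Rightarrow> real \<Rightarrow> bool" where
  "robust k x y \<epsilon> \<longleftrightarrow>
     (\<forall>n \<theta> a. index_cycle k n \<theta> \<longrightarrow> (\<forall>i\<in>{1..n}. norm (a (\<theta> i)) \<le> \<epsilon>) \<longrightarrow>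
        matched_cost x y n \<theta> \<le> shifted_cost x y n \<theta> a)"

text \<open>The value \<open>\<infinity>\<close> is possible, for instance for \<open>k = 1\<close>.\<close>

definition robustness ::
    "nat \<Rightarrow> (nat \<Rightarrow> 'a::real_normed_vector) \<Rightarrow> (nat \<Rightarrow> 'a) \<Rightarrow> ereal" where
  "robustness k x y = Sup {ereal \<epsilon> | \<epsilon>. 0 \<le> \<epsilon> \<and> robust k x y \<epsilon>}"

definition max_gain ::
    "nat \<Rightarrow> (nat \<Rightarrow> 'a::real_normed_vector) \<Rightarrow> (nat \<Rightarrow> 'a) \<Rightarrow> real \<Rightarrow> ereal" where
  "max_gain k x y M =
     Sup {ereal (matched_cost x y n \<theta> - shifted_cost x y n \<theta> a) | n \<theta> a.
            index_cycle k n \<theta> \<and> (\<forall>i\<in>{1..n}. norm (a (\<theta> i)) \<le> M)}"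

end

theory Submission
  imports Defs
begin

text \<open>Given a cycle and shifts \<open>a\<close> with \<open>norm a \<le> M\<close> and gain \<open>g\<close>, start from the coupling that moves
  \<open>x\<^sub>i + Z\<close> to \<open>y\<^sub>i + Z\<close> with \<open>Z\<close> Gaussian. Since \<open>norm z ^ 2 \<le> 2 norm a ^ 2 + 2 norm (z - a) ^ 2\<close>, the
  density of \<open>Z\<close> dominates \<open>2 powr (- d / 2) * exp (- M ^ 2 / \<sigma> ^ 2)\<close> times the Gaussian density of
  standard deviation \<open>\<sigma> / sqrt 2\<close> centred at \<open>a\<close>. Hence mass \<open>m\<close>, which is this factor times the
  least weight, can be taken off around each \<open>x\<^sub>i + a\<^sub>i\<close> and \<open>y\<^sub>i + a\<^sub>i\<close> and recoupled, by
  translations, from \<open>x\<^sub>i + a\<^sub>i\<close> to the next \<open>y\<^sub>j + a\<^sub>j\<close> of the cycle. The common noise cancels, so the cost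
  drops by exactly \<open>m * g\<close>.\<close>

section \<open>Mixtures of Lebesgue densities, and convolutions of discrete measures with a
  density\<close>

text \<open>The finite sum over \<open>I\<close> of the images under \<open>T i\<close> of the
  measures with density \<open>f i\<close>, encoded as a single image measure. The coupling is built
  in this form, with two pieces per label.\<close>

definition lborel_mixture ::
    "'i set \<Rightarrow> ('i \<Rightarrow> 'a::euclidean_space \<Rightarrow> ennreal) \<Rightarrow> ('i \<Rightarrow> 'a \<Rightarrow> 'b::topological_space) \<Rightarrow> 'b measure"
  where "lborel_mixture I f T =
    distr (density (count_space I \<Otimes>\<^sub>M lborel) (\<lambda>(i, z). f i z)) borel (\<lambda>(i, z). T i z)"

lemma sets_lborel_mixture [simp]: "sets (lborel_mixture I f T) = sets borel"
  by (simp add: lborel_mixture_def)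

text \<open>Tonelli for counting measure times Lebesgue measure. Both marginals and the cost of the
  coupling are read off from this formula.\<close>

lemma nn_integral_lborel_mixture:
  assumes "finite I"
    and f: "\<And>i. i \<in> I \<Longrightarrow> f i \<in> borel_measurable borel"
    and T: "\<And>i. i \<in> I \<Longrightarrow> T i \<in> borel_measurable borel"
    and [measurable]: "h \<in> borel_measurable borel"
  shows "(\<integral>\<^sup>+p. h p \<partial>lborel_mixture I f T) = (\<Sum>i\<in>I. \<integral>\<^sup>+z. f i z * h (T i z) \<partial>lborel)"
proof -
  \<comment> \<open>The index space is discrete and finite, so measurability in \<open>z\<close> for
    each fixed index is enough.\<close>
  have [measurable]: "(\<lambda>(i, z). f i z) \<in> borel_measurable (count_space I \<Otimes>\<^sub>M lborel)"
    by (rule measurable_pair_measure_countable1)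
       (use assms in \<open>auto simp: countable_finite\<close>)
  have [measurable]: "(\<lambda>(i, z). T i z) \<in> (count_space I \<Otimes>\<^sub>M lborel) \<rightarrow>\<^sub>M borel"
    by (rule measurable_pair_measure_countable1)
       (use assms in \<open>auto simp: countable_finite\<close>)
  have "(\<integral>\<^sup>+p. h p \<partial>lborel_mixture I f T)
      = (\<integral>\<^sup>+q. (case q of (i, z) \<Rightarrow> f i z) * h (case q of (i, z) \<Rightarrow> T i z)
           \<partial>(count_space I \<Otimes>\<^sub>M lborel))"
    unfolding lborel_mixture_def
    by (simp add: nn_integral_distr nn_integral_density)
  also have "\<dots> = (\<integral>\<^sup>+i. \<integral>\<^sup>+z. f i z * h (T i z) \<partial>lborel \<partial>count_space I)"
    by (subst lborel.nn_integral_fst [symmetric]) simp_all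
  finally show ?thesis
    by (simp add: nn_integral_count_space_finite \<open>finite I\<close>)
qed

lemma nn_integral_lborel_shift:
  fixes c :: "'a::euclidean_space"
  assumes [measurable]: "f \<in> borel_measurable borel"
  shows "(\<integral>\<^sup>+z. f (c + z) \<partial>lborel) = (\<integral>\<^sup>+z. f z \<partial>lborel)"
  by (subst lborel_distr_plus [of c, symmetric]) (simp add: nn_integral_distr)

lemma nn_integral_discrete_measure:
  assumes "h \<in> borel_measurable borel"
  shows "(\<integral>\<^sup>+p. h p \<partial>discrete_measure k w x) = (\<Sum>i=1..k. ennreal (w i) * h (x i))"
  unfolding discrete_measure_def using assms
  by (simp add: nn_integral_distr nn_integral_point_measure_finite measurable_point_measure_eq1)

lemma prob_space_discrete_measure:
  assumes "\<And>i. i \<in> {1..k} \<Longrightarrow> 0 \<le> w i" and "(\<Sum>i=1..k. w i) = 1"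
  shows "prob_space (discrete_measure k w x)"
proof
  show "emeasure (discrete_measure k w x) (space (discrete_measure k w x)) = 1"
    using nn_integral_discrete_measure[of "\<lambda>_. 1" k w x] sum_ennreal[of "{1..k}" w] assms
    by simp
qed

text \<open>Brings the convolution into the shape of a mixture integral, one term per atom with the
  noise density inside, so that marginals can be compared term by term.\<close>

lemma nn_integral_discrete_convolution:
  fixes x :: "nat \<Rightarrow> 'a::ordered_euclidean_space"
  assumes w: "\<And>i. i \<in> {1..k} \<Longrightarrow> 0 \<le> w i" "(\<Sum>i=1..k. w i) = 1"
    and [measurable]: "\<phi> \<in> borel_measurable borel"
    and \<phi>: "(\<integral>\<^sup>+z. \<phi> z \<partial>lborel) = 1"
    and [measurable]: "g \<in> borel_measurable borel"
  shows "(\<integral>\<^sup>+p. g p \<partial>(discrete_measure k w x \<star> density lborel \<phi>))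
       = (\<Sum>i=1..k. \<integral>\<^sup>+z. ennreal (w i) * \<phi> z * g (x i + z) \<partial>lborel)"
proof -
  interpret X: prob_space "discrete_measure k w x"
    using w by (rule prob_space_discrete_measure)
  interpret N: prob_space "density lborel \<phi>"
    by standard (simp add: emeasure_density \<phi>)
  have [measurable_cong]: "sets (discrete_measure k w x) = sets borel"
    by (simp add: discrete_measure_def)
  have "(\<integral>\<^sup>+p. g p \<partial>(discrete_measure k w x \<star> density lborel \<phi>))
      = (\<integral>\<^sup>+p. \<integral>\<^sup>+z. g (p + z) \<partial>density lborel \<phi> \<partial>discrete_measure k w x)"
    by (rule nn_integral_convolution)
       (simp_all add: X.finite_measure_axioms N.finite_measure_axioms
          \<open>sets (discrete_measure k w x) = sets borel\<close>)
  also have "\<dots> = (\<Sum>i=1..k. ennreal (w i) * (\<integral>\<^sup>+z. g (x i + z) \<partial>density lborel \<phi>))"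
    by (rule nn_integral_discrete_measure) measurable
  finally show ?thesis
    by (simp add: nn_integral_density nn_integral_cmult mult.assoc)
qed

lemma measure_eqI_nn_integral:
  assumes "sets A = sets M" "sets B = sets M"
    and "\<And>g. g \<in> borel_measurable M \<Longrightarrow> (\<integral>\<^sup>+p. g p \<partial>A) = (\<integral>\<^sup>+p. g p \<partial>B)"
  shows "A = B"
proof (rule measure_eqI)
  show "sets A = sets B" using assms by simp
  fix X assume "X \<in> sets A"
  then show "emeasure A X = emeasure B X"
    using assms(3)[of "indicator X"] assms(1,2) by simp
qed

section \<open>The recoupled plan and its cost\<close>

text \<open>By \<open>le\<close>, the slice \<open>m * u (z - a i)\<close> fits under the noise of
  label \<open>i\<close>, and the same slice is cut out on the \<open>x\<close> side and on the
  \<open>y\<close> side. All slices are translates of one another, so they can be rematched along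
  \<open>\<tau>\<close> without changing either marginal. The bound is the cost of that
  plan.\<close>

lemma W2_squared_smoothed_le:
  fixes x y :: "nat \<Rightarrow> 'a::ordered_euclidean_space"
  assumes w: "\<And>i. i \<in> {1..k} \<Longrightarrow> 0 \<le> w i" "(\<Sum>i=1..k. w i) = 1"
    and \<tau>: "bij_betw \<tau> {1..k} {1..k}"
    and [measurable]: "\<phi> \<in> borel_measurable borel" "u \<in> borel_measurable borel"
    and \<phi>: "(\<integral>\<^sup>+z. ennreal (\<phi> z) \<partial>lborel) = 1"
    and u: "(\<integral>\<^sup>+z. ennreal (u z) \<partial>lborel) = 1"
    and nonneg: "0 \<le> m" "\<And>z. 0 \<le> u z"
    and le: "\<And>i z. i \<in> {1..k} \<Longrightarrow> m * u (z - a i) \<le> w i * \<phi> z"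
  defines "N \<equiv> density lborel (\<lambda>z. ennreal (\<phi> z))"
  shows "W2_squared (discrete_measure k w x \<star> N) (discrete_measure k w y \<star> N)
    \<le> ereal ((\<Sum>i=1..k. w i * (norm (x i - y i))\<^sup>2)
        - m * (\<Sum>i=1..k. (norm (x i - y i))\<^sup>2 - (norm ((x i + a i) - (y (\<tau> i) + a (\<tau> i))))\<^sup>2))"
proof -
  \<comment> \<open>\<open>r i\<close> is the noise left at label \<open>i\<close> once its slice is
    removed. The left summand of \<open>I\<close> carries it from \<open>x i\<close> to
    \<open>y i\<close>; the right summand carries the slices along \<open>\<tau>\<close>, with the
    translation by \<open>a\<close> placed in \<open>T\<close> instead of the density.\<close>
  define r where "r i z = w i * \<phi> z - m * u (z - a i)" for i z
  define f where "f = case_sum (\<lambda>i z. ennreal (r i z)) (\<lambda>i::nat. \<lambda>z. ennreal (m * u z))"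
  define T where "T = case_sum (\<lambda>i z. (x i + z, y i + z))
    (\<lambda>i z. (x i + a i + z, y (\<tau> i) + a (\<tau> i) + z))"
  define I where "I = {1..k} <+> {1..k}"
  define \<pi> where "\<pi> = lborel_mixture I f T"
  have [measurable]: "r i \<in> borel_measurable borel" for i
    unfolding r_def by measurable
  have r_nonneg: "0 \<le> r i z" if "i \<in> {1..k}" for i z
    using le[OF that] by (simp add: r_def)
  have split: "ennreal (r i z) + ennreal (m * u (z - a i)) = ennreal (w i) * ennreal (\<phi> z)"
    if "i \<in> {1..k}" for i z
    using r_nonneg[OF that, of z] nonneg w(1)[OF that]
    by (simp add: ennreal_plus[symmetric] ennreal_mult'[symmetric] del: ennreal_plus) (simp add: r_def)
  have int_\<pi>: "(\<integral>\<^sup>+p. h p \<partial>\<pi>) = (\<Sum>i=1..k. \<integral>\<^sup>+z. ennreal (r i z) * h (x i + z, y i + z) \<partial>lborel)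
      + (\<Sum>i=1..k. \<integral>\<^sup>+z. ennreal (m * u z) * h (x i + a i + z, y (\<tau> i) + a (\<tau> i) + z) \<partial>lborel)"
    if "h \<in> borel_measurable borel" for h
    unfolding \<pi>_def using that
    by (subst nn_integral_lborel_mixture)
       (auto simp: I_def f_def T_def sum.Plus borel_measurable_continuous_onI split: sum.split
         intro!: continuous_intros)
  \<comment> \<open>Translation invariance moves the offset \<open>b\<close> from the argument of
    \<open>g\<close> into the density, where the slice can be added to the remainder of the same
    label.\<close>
  have shift: "(\<integral>\<^sup>+z. ennreal (m * u z) * g (c + b + z) \<partial>lborel)
      = (\<integral>\<^sup>+z. ennreal (m * u (z - b)) * g (c + z) \<partial>lborel)"
    if [measurable]: "g \<in> borel_measurable borel" for g and b c :: 'a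
    using nn_integral_lborel_shift[of "\<lambda>z. ennreal (m * u (z - b)) * g (c + z)" b]
    by (simp add: ac_simps)
  \<comment> \<open>Remainder and slice depend on the label and not on the position of the atom, so
    one computation with a generic \<open>v\<close> serves both marginals.\<close>
  have merge: "(\<Sum>i=1..k. \<integral>\<^sup>+z. ennreal (r i z) * g (v i + z) \<partial>lborel)
      + (\<Sum>i=1..k. \<integral>\<^sup>+z. ennreal (m * u z) * g (v i + a i + z) \<partial>lborel)
      = (\<integral>\<^sup>+p. g p \<partial>(discrete_measure k w v \<star> N))"
    if [measurable]: "g \<in> borel_measurable borel" for g v
    unfolding N_def
    by (subst nn_integral_discrete_convolution[OF w])
       (auto simp: \<phi> shift sum.distrib[symmetric] nn_integral_add[symmetric] distrib_right[symmetric] split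
         intro!: sum.cong nn_integral_cong)
  have sets_conv: "sets (discrete_measure k w v \<star> N) = sets borel" for v :: "nat \<Rightarrow> 'a"
    by (simp add: convolution_def)
  have [measurable]: "fst \<in> borel_measurable (borel :: ('a \<times> 'a) measure)"
      "snd \<in> borel_measurable (borel :: ('a \<times> 'a) measure)"
    by (auto intro!: borel_measurable_continuous_onI continuous_intros)
  have "distr \<pi> (discrete_measure k w x \<star> N) fst = (discrete_measure k w x \<star> N)"
  proof (rule measure_eqI_nn_integral[where M = borel])
    fix g :: "'a \<Rightarrow> ennreal" assume g[measurable]: "g \<in> borel_measurable borel"
    have "(\<integral>\<^sup>+p. g p \<partial>distr \<pi> (discrete_measure k w x \<star> N) fst) = (\<integral>\<^sup>+p. g (fst p) \<partial>\<pi>)"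
      by (intro nn_integral_distr) (simp_all add: sets_conv \<pi>_def cong: measurable_cong_sets)
    then show "(\<integral>\<^sup>+p. g p \<partial>distr \<pi> (discrete_measure k w x \<star> N) fst)
        = (\<integral>\<^sup>+p. g p \<partial>(discrete_measure k w x \<star> N))"
      by (simp add: int_\<pi> merge del: One_nat_def)
  qed (simp_all add: sets_conv)
  moreover have "distr \<pi> (discrete_measure k w y \<star> N) snd = (discrete_measure k w y \<star> N)"
  proof (rule measure_eqI_nn_integral[where M = borel])
    fix g :: "'a \<Rightarrow> ennreal" assume g[measurable]: "g \<in> borel_measurable borel"
    have "(\<integral>\<^sup>+p. g p \<partial>distr \<pi> (discrete_measure k w y \<star> N) snd) = (\<integral>\<^sup>+p. g (snd p) \<partial>\<pi>)"
      by (intro nn_integral_distr) (simp_all add: sets_conv \<pi>_def cong: measurable_cong_sets)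
    \<comment> \<open>The slices arrive at the labels \<open>\<tau> i\<close>; as
      \<open>\<tau>\<close> is a bijection, reindexing the sum restores one slice per label.\<close>
    then show "(\<integral>\<^sup>+p. g p \<partial>distr \<pi> (discrete_measure k w y \<star> N) snd)
        = (\<integral>\<^sup>+p. g p \<partial>(discrete_measure k w y \<star> N))"
      by (simp del: One_nat_def add: int_\<pi> merge[symmetric]
          sum.reindex_bij_betw[OF \<tau>, of "\<lambda>i. \<integral>\<^sup>+z. ennreal (m * u z) * g (y i + a i + z) \<partial>lborel"])
  qed (simp_all add: sets_conv)
  moreover have "sets \<pi> = sets ((discrete_measure k w x \<star> N) \<Otimes>\<^sub>M (discrete_measure k w y \<star> N))"
    by (simp add: \<pi>_def sets_conv borel_prod[symmetric] cong: sets_pair_measure_cong)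
  ultimately have coupling: "\<pi> \<in> couplings (discrete_measure k w x \<star> N) (discrete_measure k w y \<star> N)"
    by (simp add: couplings_def)
  have int_r: "(\<integral>\<^sup>+z. ennreal (r i z) \<partial>lborel) = ennreal (w i - m)" if i: "i \<in> {1..k}" for i
  proof -
    have "(\<integral>\<^sup>+z. ennreal (m * u (z - a i)) \<partial>lborel) = ennreal m"
      using shift[of "\<lambda>_. 1" 0 "a i"] nonneg by (simp add: ennreal_mult nn_integral_cmult u)
    moreover have "(\<integral>\<^sup>+z. ennreal (r i z) \<partial>lborel) + (\<integral>\<^sup>+z. ennreal (m * u (z - a i)) \<partial>lborel) = ennreal (w i)"
      by (simp add: nn_integral_add[symmetric] split[OF i] nn_integral_cmult \<phi>)
    ultimately have "(\<integral>\<^sup>+z. ennreal (r i z) \<partial>lborel) + ennreal m = ennreal (w i)"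
      by simp
    \<comment> \<open>Subtracting \<open>m\<close> on both sides is sound in \<open>ennreal\<close>
      because \<open>m\<close> is finite.\<close>
    then show ?thesis
      using nonneg(1) by (metis ennreal_add_diff_cancel_right ennreal_minus ennreal_neq_top)
  qed
  \<comment> \<open>Follows by integrating \<open>le\<close>. It makes the coefficients
    \<open>w i - m\<close> nonnegative, so that the cost can be passed from \<open>ennreal\<close>
    to the reals.\<close>
  have m_le: "m \<le> w i" if i: "i \<in> {1..k}" for i
  proof -
    have "ennreal m = (\<integral>\<^sup>+z. ennreal (m * u (z - a i)) \<partial>lborel)"
      using shift[of "\<lambda>_. 1" 0 "a i"] nonneg by (simp add: ennreal_mult nn_integral_cmult u)
    also have "\<dots> \<le> (\<integral>\<^sup>+z. ennreal (w i) * ennreal (\<phi> z) \<partial>lborel)"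
      using le[OF i] w(1)[OF i] by (intro nn_integral_mono) (simp add: ennreal_mult'[symmetric] ennreal_leI)
    finally show ?thesis
      using w(1)[OF i] by (simp add: nn_integral_cmult \<phi>)
  qed
  \<comment> \<open>On each piece the common \<open>z\<close> cancels in the difference, so the
    integrand is constant and only the masses \<open>w i - m\<close> and \<open>m\<close>
    remain.\<close>
  have "quadratic_cost \<pi> = (\<Sum>i=1..k. ennreal ((w i - m) * (norm (x i - y i))\<^sup>2))
      + (\<Sum>i=1..k. ennreal (m * (norm ((x i + a i) - (y (\<tau> i) + a (\<tau> i))))\<^sup>2))"
    unfolding quadratic_cost_def using nonneg m_le
    by (subst int_\<pi>)
       (auto simp: nn_integral_multc int_r ennreal_mult nn_integral_cmult u
         intro!: arg_cong2[of _ _ _ _ "(+)"] sum.cong)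
  also have "\<dots> = ennreal ((\<Sum>i=1..k. (w i - m) * (norm (x i - y i))\<^sup>2)
      + (\<Sum>i=1..k. m * (norm ((x i + a i) - (y (\<tau> i) + a (\<tau> i))))\<^sup>2))"
    using m_le nonneg
    by (subst ennreal_plus) (auto intro!: sum_nonneg mult_nonneg_nonneg sum_ennreal arg_cong2[of _ _ _ _ "(+)"])
  finally have cost: "quadratic_cost \<pi> = ennreal ((\<Sum>i=1..k. (w i - m) * (norm (x i - y i))\<^sup>2)
      + (\<Sum>i=1..k. m * (norm ((x i + a i) - (y (\<tau> i) + a (\<tau> i))))\<^sup>2))" .
  have "W2_squared (discrete_measure k w x \<star> N) (discrete_measure k w y \<star> N)
      \<le> enn2ereal (quadratic_cost \<pi>)"
    unfolding W2_squared_def less_eq_ennreal.rep_eq[symmetric] using coupling by (rule INF_lower)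
  also have "\<dots> = ereal ((\<Sum>i=1..k. (w i - m) * (norm (x i - y i))\<^sup>2)
      + (\<Sum>i=1..k. m * (norm ((x i + a i) - (y (\<tau> i) + a (\<tau> i))))\<^sup>2))"
    unfolding cost using m_le nonneg by (intro enn2ereal_ennreal add_nonneg_nonneg sum_nonneg) auto
  also have "\<dots> = ereal ((\<Sum>i=1..k. w i * (norm (x i - y i))\<^sup>2)
        - m * (\<Sum>i=1..k. (norm (x i - y i))\<^sup>2 - (norm ((x i + a i) - (y (\<tau> i) + a (\<tau> i))))\<^sup>2))"
    by (simp add: sum_distrib_left sum_subtractf left_diff_distrib right_diff_distrib)
  finally show ?thesis .
qed

section \<open>Gaussian densities and their translates\<close>

text \<open>The density inside \<open>gaussian\<close>, as a real function that can be translated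
  and compared for two standard deviations.\<close>

definition gaussian_density :: "real \<Rightarrow> real ^ 'n \<Rightarrow> real" where
  "gaussian_density \<sigma> z = (\<Prod>i\<in>UNIV. normal_density 0 \<sigma> (z $ i))"

lemma gaussian_density_nonneg: "0 \<le> gaussian_density \<sigma> z"
  by (simp add: gaussian_density_def prod_nonneg)

lemma borel_measurable_gaussian_density [measurable]: "gaussian_density \<sigma> \<in> borel_measurable borel"
  unfolding gaussian_density_def[abs_def] by measurable

lemma nn_integral_gaussian_density:
  fixes \<sigma> :: real
  assumes "0 < \<sigma>"
  shows "(\<integral>\<^sup>+z. ennreal (gaussian_density \<sigma> (z :: real ^ 'n)) \<partial>lborel) = 1"
proof -
  interpret prob_space "density lborel (normal_density 0 \<sigma>)"
    using assms by (rule prob_space_normal_density)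
  have one: "(\<integral>\<^sup>+t. ennreal (normal_density 0 \<sigma> t) \<partial>lborel) = 1"
    using emeasure_space_1 by (simp add: emeasure_density)
  \<comment> \<open>\<open>gaussian_density\<close> multiplies over the index type, while the
    product formula for \<open>lborel\<close> runs over \<open>Basis\<close>;
    \<open>axis i 1\<close> matches the two.\<close>
  have bij: "bij_betw (\<lambda>i::'n. axis i (1::real)) UNIV Basis"
    by (auto simp: bij_betw_def inj_on_def axis_eq_axis Basis_vec_def)
  have "ennreal (gaussian_density \<sigma> z) = (\<Prod>b\<in>Basis. ennreal (normal_density 0 \<sigma> (z \<bullet> b)))"
    for z :: "real ^ 'n"
    by (simp add: gaussian_density_def prod_ennreal inner_axis prod.reindex_bij_betw[OF bij, symmetric])
  then have "(\<integral>\<^sup>+z. ennreal (gaussian_density \<sigma> (z :: real ^ 'n)) \<partial>lborel)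
      = (\<integral>\<^sup>+z. (\<Prod>b\<in>Basis. ennreal (normal_density 0 \<sigma> (z \<bullet> b))) \<partial>(lborel :: (real ^ 'n) measure))"
    by simp
  also have "\<dots> = (\<Prod>b\<in>(Basis :: (real ^ 'n) set). \<integral>\<^sup>+t. ennreal (normal_density 0 \<sigma> t) \<partial>lborel)"
    by (rule nn_integral_lborel_prod) simp_all
  finally show ?thesis
    by (simp add: one)
qed

text \<open>The factor 2 before \<open>(t - b)\<^sup>2\<close> in \<open>sq\<close> halves the
  variance, hence the deviation \<open>\<sigma> / sqrt 2\<close>; the factor
  \<open>1 / sqrt 2\<close> is the ratio of the normalising constants.\<close>

lemma normal_density_shift_le:
  assumes "0 < \<sigma>"
  shows "exp (- (b\<^sup>2 / \<sigma>\<^sup>2)) / sqrt 2 * normal_density 0 (\<sigma> / sqrt 2) (t - b) \<le> normal_density 0 \<sigma> t"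
proof -
  \<comment> \<open>The right side exceeds the left by exactly
    \<open>(t - 2 * b)\<^sup>2\<close>.\<close>
  have sq: "t\<^sup>2 \<le> 2 * b\<^sup>2 + 2 * (t - b)\<^sup>2"
    using zero_le_power2[of "t - 2 * b"] by (simp add: power2_eq_square algebra_simps)
  then have "t\<^sup>2 / (2 * \<sigma>\<^sup>2) \<le> (2 * b\<^sup>2 + 2 * (t - b)\<^sup>2) / (2 * \<sigma>\<^sup>2)"
    by (rule divide_right_mono) simp
  also have "\<dots> = b\<^sup>2 / \<sigma>\<^sup>2 + (t - b)\<^sup>2 / \<sigma>\<^sup>2"
    using assms by (simp add: field_simps)
  finally have "exp (- (b\<^sup>2 / \<sigma>\<^sup>2)) * exp (- ((t - b)\<^sup>2 / \<sigma>\<^sup>2)) \<le> exp (- (t\<^sup>2 / (2 * \<sigma>\<^sup>2)))"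
    by (simp add: exp_add[symmetric])
  moreover have "sqrt 2 * sqrt (2 * pi * \<sigma>\<^sup>2 / 2) = sqrt (2 * pi * \<sigma>\<^sup>2)"
    by (simp add: real_sqrt_mult[symmetric])
  ultimately show ?thesis
    using assms
    by (simp add: normal_density_def power_divide real_sqrt_mult real_sqrt_divide divide_right_mono field_simps)
qed

text \<open>Multiply the one-dimensional bounds: the exponents add up to the squared norm of
  \<open>b\<close>, and each coordinate contributes one factor \<open>1 / sqrt 2\<close>.\<close>

lemma gaussian_density_shift_le:
  fixes z b :: "real ^ 'n"
  assumes "0 < \<sigma>"
  shows "exp (- ((norm b)\<^sup>2 / \<sigma>\<^sup>2)) / sqrt 2 ^ CARD('n) * gaussian_density (\<sigma> / sqrt 2) (z - b)
    \<le> gaussian_density \<sigma> z"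
proof -
  have "(norm b)\<^sup>2 = (\<Sum>i\<in>UNIV. (b $ i)\<^sup>2)"
    unfolding power2_norm_eq_inner inner_vec_def by (simp add: power2_eq_square)
  then have "exp (- ((norm b)\<^sup>2 / \<sigma>\<^sup>2)) = (\<Prod>i\<in>UNIV. exp (- ((b $ i)\<^sup>2 / \<sigma>\<^sup>2)))"
    by (simp add: exp_sum[symmetric] sum_negf sum_divide_distrib)
  then have "exp (- ((norm b)\<^sup>2 / \<sigma>\<^sup>2)) / sqrt 2 ^ CARD('n) * gaussian_density (\<sigma> / sqrt 2) (z - b)
      = (\<Prod>i\<in>UNIV. exp (- ((b $ i)\<^sup>2 / \<sigma>\<^sup>2)) / sqrt 2 * normal_density 0 (\<sigma> / sqrt 2) (z $ i - b $ i))"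
    by (simp add: gaussian_density_def prod.distrib prod_dividef)
  also have "\<dots> \<le> gaussian_density \<sigma> z"
    unfolding gaussian_density_def using normal_density_shift_le[OF assms]
    by (intro prod_mono) simp
  finally show ?thesis .
qed

section \<open>From cycles to permutations of all labels\<close>

lemma cyc_next_bij: "1 \<le> n \<Longrightarrow> bij_betw (cyc_next n) {1..n} {1..n}"
  by (rule bij_betw_byWitness[where f' = "\<lambda>i. if i = 1 then n else i - 1"])
     (auto simp: cyc_next_def)

text \<open>A coupling has to treat all labels, so the cycle is extended by the identity and the
  shifts by zero. Labels off the cycle then contribute nothing to the gain.\<close>

lemma index_cycle_permutation:
  fixes x y a :: "nat \<Rightarrow> 'a::real_normed_vector"
  assumes cyc: "index_cycle k n \<theta>" and a: "\<And>i. i \<in> {1..n} \<Longrightarrow> norm (a (\<theta> i)) \<le> M" and "0 \<le> M"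
  obtains \<tau> b where "bij_betw \<tau> {1..k} {1..k}" and "\<And>i. norm (b i) \<le> M"
    and "(\<Sum>i=1..k. (norm (x i - y i))\<^sup>2 - (norm ((x i + b i) - (y (\<tau> i) + b (\<tau> i))))\<^sup>2)
         = matched_cost x y n \<theta> - shifted_cost x y n \<theta> a"
proof -
  define A where "A = \<theta> ` {1..n}"
  have inj: "inj_on \<theta> {1..n}" and sub: "A \<subseteq> {1..k}" and n: "1 \<le> n"
    using cyc by (auto simp: index_cycle_def A_def)
  have bij\<theta>: "bij_betw \<theta> {1..n} A"
    using inj by (simp add: bij_betw_def A_def)
  \<comment> \<open>\<open>inv_into\<close> recovers the position of a label in the cycle, which is
    unique since \<open>\<theta>\<close> is injective.\<close>
  define \<tau> where "\<tau> i = (if i \<in> A then \<theta> (cyc_next n (inv_into {1..n} \<theta> i)) else i)" for i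
  define b where "b i = (if i \<in> A then a i else 0)" for i
  let ?g = "\<lambda>i. (norm (x i - y i))\<^sup>2 - (norm ((x i + b i) - (y (\<tau> i) + b (\<tau> i))))\<^sup>2"
  have "bij_betw (\<theta> \<circ> cyc_next n \<circ> inv_into {1..n} \<theta>) A A"
    using bij\<theta> cyc_next_bij[OF n] bij_betw_inv_into[OF bij\<theta>] by (blast intro: bij_betw_trans)
  then have "bij_betw \<tau> A A"
    by (rule bij_betw_cong[THEN iffD1, rotated]) (simp add: \<tau>_def)
  moreover have "bij_betw \<tau> ({1..k} - A) ({1..k} - A)"
    by (rule bij_betw_cong[THEN iffD1, rotated, OF bij_betw_id]) (simp add: \<tau>_def)
  ultimately have "bij_betw \<tau> (A \<union> ({1..k} - A)) (A \<union> ({1..k} - A))"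
    by (rule bij_betw_combine) blast
  then have 1: "bij_betw \<tau> {1..k} {1..k}"
    using sub by (simp add: Un_absorb1)
  have 2: "norm (b i) \<le> M" for i
    using a \<open>0 \<le> M\<close> by (auto simp: b_def A_def)
  have nxt: "cyc_next n i \<in> {1..n}" if "i \<in> {1..n}" for i
    using that by (auto simp: cyc_next_def)
  have "(\<Sum>i=1..k. ?g i) = (\<Sum>i\<in>A. ?g i)"
    using sub by (intro sum.mono_neutral_right) (auto simp: \<tau>_def b_def)
  also have "\<dots> = (\<Sum>j=1..n. ?g (\<theta> j))"
    by (rule sum.reindex_bij_betw[OF bij\<theta>, symmetric])
  also have "\<dots> = (\<Sum>j=1..n. (norm (x (\<theta> j) - y (\<theta> j)))\<^sup>2 - (norm ((x (\<theta> j) + a (\<theta> j))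
                    - (y (\<theta> (cyc_next n j)) + a (\<theta> (cyc_next n j)))))\<^sup>2)"
  proof (rule sum.cong[OF refl])
    fix j assume j: "j \<in> {1..n}"
    \<comment> \<open>Both labels of the term lie on the cycle, so \<open>b\<close> agrees with
      \<open>a\<close> at each of them.\<close>
    then have "\<theta> j \<in> A" "\<theta> (cyc_next n j) \<in> A"
      using nxt[OF j] by (auto simp: A_def)
    moreover from this j have "\<tau> (\<theta> j) = \<theta> (cyc_next n j)"
      by (simp add: \<tau>_def inv_into_f_f[OF inj j] del: One_nat_def)
    ultimately show "?g (\<theta> j) = (norm (x (\<theta> j) - y (\<theta> j)))\<^sup>2 - (norm ((x (\<theta> j) + a (\<theta> j))
                    - (y (\<theta> (cyc_next n j)) + a (\<theta> (cyc_next n j)))))\<^sup>2"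
      by (simp add: b_def)
  qed
  finally have 3: "(\<Sum>i=1..k. ?g i) = matched_cost x y n \<theta> - shifted_cost x y n \<theta> a"
    by (simp add: matched_cost_def shifted_cost_def sum_subtractf)
  show ?thesis
    using 1 2 3 by (rule that)
qed

section \<open>Upper bound after smoothing, value before smoothing, and the resulting drop\<close>

text \<open>Uses slices of Gaussian shape with deviation \<open>\<sigma> / sqrt 2\<close>. A single
  mass \<open>m\<close> has to fit at every label, which is why the weights enter through the lower
  bound \<open>w\<^sub>0\<close> and the shifts through the bound \<open>M\<close>.\<close>

lemma W2_squared_gaussian_le:
  fixes x y a :: "nat \<Rightarrow> real ^ 'n"
  assumes w: "\<And>i. i \<in> {1..k} \<Longrightarrow> w\<^sub>0 \<le> w i" "0 < w\<^sub>0" "(\<Sum>i=1..k. w i) = 1"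
    and cyc: "index_cycle k n \<theta>" and a: "\<And>i. i \<in> {1..n} \<Longrightarrow> norm (a (\<theta> i)) \<le> M"
    and "0 \<le> M" and "0 < \<sigma>"
  shows "W2_squared (discrete_measure k w x \<star> gaussian \<sigma>) (discrete_measure k w y \<star> gaussian \<sigma>)
    \<le> ereal ((\<Sum>i=1..k. w i * (norm (x i - y i))\<^sup>2)
        - w\<^sub>0 / sqrt 2 ^ CARD('n) * exp (- (M\<^sup>2 / \<sigma>\<^sup>2)) * (matched_cost x y n \<theta> - shifted_cost x y n \<theta> a))"
proof -
  obtain \<tau> b where \<tau>: "bij_betw \<tau> {1..k} {1..k}" and b: "\<And>i. norm (b i) \<le> M"
    and gain: "(\<Sum>i=1..k. (norm (x i - y i))\<^sup>2 - (norm ((x i + b i) - (y (\<tau> i) + b (\<tau> i))))\<^sup>2)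
         = matched_cost x y n \<theta> - shifted_cost x y n \<theta> a"
    by (rule index_cycle_permutation[where x = x and y = y and a = a, OF cyc _ \<open>0 \<le> M\<close>]) (use a in blast)+
  let ?u = "gaussian_density (\<sigma> / sqrt 2) :: real ^ 'n \<Rightarrow> real"
  have le: "w\<^sub>0 / sqrt 2 ^ CARD('n) * exp (- (M\<^sup>2 / \<sigma>\<^sup>2)) * ?u (z - b i) \<le> w i * gaussian_density \<sigma> z"
    if i: "i \<in> {1..k}" for i and z :: "real ^ 'n"
  proof -
    have "(norm (b i))\<^sup>2 / \<sigma>\<^sup>2 \<le> M\<^sup>2 / \<sigma>\<^sup>2"
      using b[of i] by (intro divide_right_mono power_mono) auto
    then have "exp (- (M\<^sup>2 / \<sigma>\<^sup>2)) / sqrt 2 ^ CARD('n) * ?u (z - b i)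
        \<le> exp (- ((norm (b i))\<^sup>2 / \<sigma>\<^sup>2)) / sqrt 2 ^ CARD('n) * ?u (z - b i)"
      by (intro mult_right_mono divide_right_mono) (auto simp: gaussian_density_nonneg)
    also have "\<dots> \<le> gaussian_density \<sigma> z"
      by (rule gaussian_density_shift_le[OF \<open>0 < \<sigma>\<close>])
    finally have "w\<^sub>0 * (exp (- (M\<^sup>2 / \<sigma>\<^sup>2)) / sqrt 2 ^ CARD('n) * ?u (z - b i)) \<le> w i * gaussian_density \<sigma> z"
      using w(1)[OF i] w(2)
      by (intro mult_mono) (auto simp: gaussian_density_nonneg)
    then show ?thesis
      by (simp add: mult.assoc)
  qed
  have "W2_squared (discrete_measure k w x \<star> density lborel (\<lambda>z. ennreal (gaussian_density \<sigma> z)))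
      (discrete_measure k w y \<star> density lborel (\<lambda>z. ennreal (gaussian_density \<sigma> z)))
    \<le> ereal ((\<Sum>i=1..k. w i * (norm (x i - y i))\<^sup>2)
        - w\<^sub>0 / sqrt 2 ^ CARD('n) * exp (- (M\<^sup>2 / \<sigma>\<^sup>2))
          * (\<Sum>i=1..k. (norm (x i - y i))\<^sup>2 - (norm ((x i + b i) - (y (\<tau> i) + b (\<tau> i))))\<^sup>2))"
  proof (rule W2_squared_smoothed_le[where u = ?u])
    show "0 \<le> w i" if "i \<in> {1..k}" for i
      using w(1)[OF that] w(2) by simp
  qed (use w \<tau> le \<open>0 < \<sigma>\<close> in \<open>auto simp: nn_integral_gaussian_density gaussian_density_nonneg
        simp del: One_nat_def\<close>)
  then show ?thesis
    by (simp only: gain gaussian_def gaussian_density_def)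
qed

text \<open>Optimality enters here: it identifies the unsmoothed distance with the cost of the
  labelled plan, the same sum from which the smoothed bound subtracts the gain.\<close>

lemma W2_squared_discrete_measure:
  fixes x y :: "nat \<Rightarrow> 'a::euclidean_space"
  assumes "optimal_plan (discrete_measure k w (\<lambda>i. (x i, y i))) \<mu> \<nu>"
    and "\<And>i. i \<in> {1..k} \<Longrightarrow> 0 \<le> w i"
  shows "W2_squared \<mu> \<nu> = ereal (\<Sum>i=1..k. w i * (norm (x i - y i))\<^sup>2)"
proof -
  have [measurable]: "(\<lambda>p. (norm (fst p - snd p))\<^sup>2) \<in> borel_measurable (borel :: ('a \<times> 'a) measure)"
    by (intro borel_measurable_continuous_onI continuous_intros)
  have "quadratic_cost (discrete_measure k w (\<lambda>i. (x i, y i)))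
      = (\<Sum>i=1..k. ennreal (w i) * ennreal ((norm (x i - y i))\<^sup>2))"
    unfolding quadratic_cost_def
    by (subst nn_integral_discrete_measure) simp_all
  also have "\<dots> = ennreal (\<Sum>i=1..k. w i * (norm (x i - y i))\<^sup>2)"
    using assms(2) by (subst sum_ennreal[symmetric]) (auto simp: ennreal_mult intro!: sum.cong)
  finally have "quadratic_cost (discrete_measure k w (\<lambda>i. (x i, y i)))
      = ennreal (\<Sum>i=1..k. w i * (norm (x i - y i))\<^sup>2)" .
  moreover have "0 \<le> (\<Sum>i=1..k. w i * (norm (x i - y i))\<^sup>2)"
    using assms(2) by (intro sum_nonneg) auto
  ultimately show ?thesis
    using assms(1) by (simp add: optimal_plan_def enn2ereal_ennreal)
qed

theorem theorem3p3:
  fixes k :: nat and w :: "nat \<Rightarrow> real"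
    and x y :: "nat \<Rightarrow> real ^ 'n"
    and \<mu> \<nu> :: "(real ^ 'n) measure"
    and \<sigma>\<^sub>s :: ereal
  assumes weights_pos: "\<And>i. i \<in> {1..k} \<Longrightarrow> 0 < w i"
    and weights_sum: "(\<Sum>i=1..k. w i) = 1"
    and x_distinct: "inj_on x {1..k}"
    and y_distinct: "inj_on y {1..k}"
    and mu: "\<mu> = discrete_measure k w x"
    and nu: "\<nu> = discrete_measure k w y"
    and optimal: "optimal_plan (discrete_measure k w (\<lambda>i. (x i, y i))) \<mu> \<nu>"
    and sigma_s: "\<sigma>\<^sub>s = robustness k x y"
    and sigma_s_pos: "0 < \<sigma>\<^sub>s"
  shows
    "(\<exists>C>0. \<exists>c>0. \<forall>\<sigma>>0.
        ereal C * (SUP M\<in>{M. \<sigma>\<^sub>s < ereal M}. ereal (exp (- c * M\<^sup>2 / \<sigma>\<^sup>2)) * max_gain k x y M)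
          \<le> W2_squared \<mu> \<nu> - W2_squared (\<mu> \<star> gaussian \<sigma>) (\<nu> \<star> gaussian \<sigma>))
     \<and>
     (\<forall>s \<kappa>. \<sigma>\<^sub>s = ereal s \<longrightarrow> 0 < \<kappa> \<longrightarrow> ereal (\<kappa> * s) \<le> max_gain k x y (3 * s) \<longrightarrow>
        (\<exists>C>0. \<exists>c>0. \<forall>\<sigma>\<in>{0<..<2 * s}.
           ereal (C * (\<sigma> * exp (- c * s\<^sup>2 / \<sigma>\<^sup>2)))
             \<le> W2_squared \<mu> \<nu> - W2_squared (\<mu> \<star> gaussian \<sigma>) (\<nu> \<star> gaussian \<sigma>)))"
proof -
  define A where "A = (\<Sum>i=1..k. w i * (norm (x i - y i))\<^sup>2)"
  define w\<^sub>0 where "w\<^sub>0 = Min (w ` {1..k})"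
  \<comment> \<open>Depends on the least weight and the dimension only, hence is uniform in
    \<open>\<sigma>\<close> and \<open>M\<close>.\<close>
  define C where "C = w\<^sub>0 / sqrt 2 ^ CARD('n)"
  have k: "1 \<le> k"
    using weights_sum by (cases k) auto
  have w\<^sub>0: "0 < w\<^sub>0" "\<And>i. i \<in> {1..k} \<Longrightarrow> w\<^sub>0 \<le> w i"
    using k weights_pos by (auto simp: w\<^sub>0_def)
  have C: "0 < C"
    using w\<^sub>0 by (simp add: C_def)
  have W2: "W2_squared \<mu> \<nu> = ereal A"
    unfolding A_def using optimal weights_pos
    by (intro W2_squared_discrete_measure) (auto intro: less_imp_le)
  define V where "V \<sigma> = W2_squared (\<mu> \<star> gaussian \<sigma>) (\<nu> \<star> gaussian \<sigma>)" for \<sigma>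
  have V_le: "V \<sigma> \<le> ereal (A - C * exp (- (M\<^sup>2 / \<sigma>\<^sup>2)) * (matched_cost x y n \<theta> - shifted_cost x y n \<theta> a))"
    if "index_cycle k n \<theta>" "\<And>i. i \<in> {1..n} \<Longrightarrow> norm (a (\<theta> i)) \<le> M" "0 \<le> M" "0 < \<sigma>" for \<sigma> M n \<theta> a
    unfolding V_def A_def C_def mu nu
    using w\<^sub>0 weights_sum that by (intro W2_squared_gaussian_le)
  have V_real: "V \<sigma> = ereal (real_of_ereal (V \<sigma>))" if "0 < \<sigma>" for \<sigma>
  proof -
    \<comment> \<open>The cycle of length one without shift has gain 0 and bounds
      \<open>V \<sigma>\<close> by the real number \<open>A\<close>; so the difference of squared
      distances is a difference of reals.\<close>
    have "index_cycle k 1 (\<lambda>_. 1)"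
      using k by (simp add: index_cycle_def)
    then have "V \<sigma> \<noteq> \<infinity>"
      using V_le[of 1 "\<lambda>_. 1" "\<lambda>_. 0" 0 \<sigma>] that by auto
    moreover have "0 \<le> V \<sigma>"
      by (simp add: V_def W2_squared_def)
    ultimately show ?thesis
      by (cases "V \<sigma>") auto
  qed
  define D where "D \<sigma> = A - real_of_ereal (V \<sigma>)" for \<sigma>
  have diff: "W2_squared \<mu> \<nu> - W2_squared (\<mu> \<star> gaussian \<sigma>) (\<nu> \<star> gaussian \<sigma>) = ereal (D \<sigma>)"
    if "0 < \<sigma>" for \<sigma>
    unfolding W2 V_def[symmetric] by (subst V_real[OF that]) (simp add: D_def)
  \<comment> \<open>\<open>V_le\<close> has the same positive factor for every cycle and every
    admissible shift, so dividing by it bounds the whole supremum.\<close>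
  have gain: "max_gain k x y M \<le> ereal (D \<sigma> / (C * exp (- (M\<^sup>2 / \<sigma>\<^sup>2))))"
    if "0 \<le> M" "0 < \<sigma>" for M \<sigma>
    unfolding max_gain_def
  proof (rule Sup_least, clarify)
    fix n \<theta> and a :: "nat \<Rightarrow> real ^ 'n"
    assume "index_cycle k n \<theta>" "\<forall>i\<in>{1..n}. norm (a (\<theta> i)) \<le> M"
    then have "V \<sigma> \<le> ereal (A - C * exp (- (M\<^sup>2 / \<sigma>\<^sup>2)) * (matched_cost x y n \<theta> - shifted_cost x y n \<theta> a))"
      using that by (intro V_le) auto
    then have "real_of_ereal (V \<sigma>)
        \<le> A - C * exp (- (M\<^sup>2 / \<sigma>\<^sup>2)) * (matched_cost x y n \<theta> - shifted_cost x y n \<theta> a)"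
      by (subst (asm) V_real[OF that(2)]) simp
    then show "ereal (matched_cost x y n \<theta> - shifted_cost x y n \<theta> a)
        \<le> ereal (D \<sigma> / (C * exp (- (M\<^sup>2 / \<sigma>\<^sup>2))))"
      using C by (simp add: D_def pos_le_divide_eq mult_ac)
  qed
  \<comment> \<open>With \<open>c = 1\<close> the exponential weight cancels the factor in
    \<open>gain\<close>, leaving \<open>D \<sigma> / C\<close> for every \<open>M\<close>. If
    \<open>\<sigma>\<^sub>s\<close> is infinite, no \<open>M\<close> qualifies and the supremum is
    \<open>-\<infinity>\<close>.\<close>
  have "ereal C * (SUP M\<in>{M. \<sigma>\<^sub>s < ereal M}. ereal (exp (- 1 * M\<^sup>2 / \<sigma>\<^sup>2)) * max_gain k x y M)
      \<le> ereal (D \<sigma>)" if "0 < \<sigma>" for \<sigma>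
  proof -
    have "(SUP M\<in>{M. \<sigma>\<^sub>s < ereal M}. ereal (exp (- 1 * M\<^sup>2 / \<sigma>\<^sup>2)) * max_gain k x y M) \<le> ereal (D \<sigma> / C)"
    proof (rule SUP_least)
      fix M assume "M \<in> {M. \<sigma>\<^sub>s < ereal M}"
      then have "0 < ereal M"
        using less_trans[OF sigma_s_pos] by blast
      then have "ereal (exp (- 1 * M\<^sup>2 / \<sigma>\<^sup>2)) * max_gain k x y M
          \<le> ereal (exp (- 1 * M\<^sup>2 / \<sigma>\<^sup>2)) * ereal (D \<sigma> / (C * exp (- (M\<^sup>2 / \<sigma>\<^sup>2))))"
        by (intro ereal_mult_left_mono gain that) auto
      then show "ereal (exp (- 1 * M\<^sup>2 / \<sigma>\<^sup>2)) * max_gain k x y M \<le> ereal (D \<sigma> / C)"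
        using C by simp
    qed
    then have "ereal C * (SUP M\<in>{M. \<sigma>\<^sub>s < ereal M}. ereal (exp (- 1 * M\<^sup>2 / \<sigma>\<^sup>2)) * max_gain k x y M)
        \<le> ereal C * ereal (D \<sigma> / C)"
      using C by (intro ereal_mult_left_mono) auto
    then show ?thesis
      using C by simp
  qed
  then have part1: "\<exists>C>0. \<exists>c>0. \<forall>\<sigma>>0.
      ereal C * (SUP M\<in>{M. \<sigma>\<^sub>s < ereal M}. ereal (exp (- c * M\<^sup>2 / \<sigma>\<^sup>2)) * max_gain k x y M)
        \<le> W2_squared \<mu> \<nu> - W2_squared (\<mu> \<star> gaussian \<sigma>) (\<nu> \<star> gaussian \<sigma>)"
    using C by (intro exI[of _ C] exI[of _ 1] conjI) (auto simp: diff)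
  have part2: "\<exists>C>0. \<exists>c>0. \<forall>\<sigma>\<in>{0<..<2 * s}. ereal (C * (\<sigma> * exp (- c * s\<^sup>2 / \<sigma>\<^sup>2)))
      \<le> W2_squared \<mu> \<nu> - W2_squared (\<mu> \<star> gaussian \<sigma>) (\<nu> \<star> gaussian \<sigma>)"
    if s: "\<sigma>\<^sub>s = ereal s" and \<kappa>: "0 < \<kappa>" "ereal (\<kappa> * s) \<le> max_gain k x y (3 * s)" for s \<kappa>
  proof -
    \<comment> \<open>The 9 is the square of 3 in \<open>M = 3 * s\<close>; the 2 comes from
      \<open>\<sigma> < 2 * s\<close>, which lets \<open>\<sigma> / 2\<close> replace
      \<open>s\<close>.\<close>
    have "C * \<kappa> / 2 * (\<sigma> * exp (- 9 * s\<^sup>2 / \<sigma>\<^sup>2)) \<le> D \<sigma>" if \<sigma>: "0 < \<sigma>" "\<sigma> < 2 * s" for \<sigma>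
    proof -
      have "ereal (\<kappa> * s) \<le> ereal (D \<sigma> / (C * exp (- ((3 * s)\<^sup>2 / \<sigma>\<^sup>2))))"
        using \<sigma> by (intro order_trans[OF \<kappa>(2) gain]) auto
      then have "\<kappa> * s * (C * exp (- 9 * s\<^sup>2 / \<sigma>\<^sup>2)) \<le> D \<sigma>"
        using C by (simp add: pos_le_divide_eq power_mult_distrib)
      moreover have "C * \<kappa> / 2 * exp (- 9 * s\<^sup>2 / \<sigma>\<^sup>2) * \<sigma> \<le> C * \<kappa> / 2 * exp (- 9 * s\<^sup>2 / \<sigma>\<^sup>2) * (2 * s)"
        using C \<kappa> \<sigma> by (intro mult_left_mono) auto
      ultimately show ?thesis
        by (simp add: mult_ac)
    qed
    then show ?thesis
      using C \<kappa>(1) by (intro exI[of _ "C * \<kappa> / 2"] exI[of _ 9] conjI) (auto simp: diff)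
  qed
  show ?thesis
    using part1 part2 by blast
qed

end
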